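(* Let $G$ be a critical net in $\mathbb{R}^k$ with finitely many leaves and contained in a bounded domain. Then the valency of an (isolated) vertex of $G$ is bounded by $|\partial X|$, and the total length $L$ of $G$ is bounded by $r\,|\partial X|$, where $r$ is the outer radius, i.e. the radius of the smallest ball containing all interior vertices.
   Context: $G$ is a graph with countable vertex set $X$, embedded in $\mathbb{R}^k$, whose edges are straight segments; $\vec x\in\mathbb{R}^k$ denotes the position of a vertex $x$. $E$ is the set of unordered edges. The valency of a vertex is its number of neighbours. A leaf is a vertex of valency $1$; $\partial X$ is the set of leaves and $X_{int}$ is the set of the other vertices, called interior vertices; there are no vertices of valency $2$. It is assumed that $|\partial X|\ge 2$ and that the leaves are isolated from the other vertices. A vertex is isolated if the vertices of $G$ do not accumulate at it. $G$ is a critical net if, for any continuous function $\vec d:X\to\mathbb{R}^k$ (continuous for the topology of $X$ as a subset of $\mathbb{R}^k$) whose support is a (compact for the topology of $\mathbb{R}^k$) subset of $X_{int}$, $$\sum_{\{x,y\}\in E}\frac{\vec x-\vec y}{\|\vec x-\vec y\|}\cdot\big(\vec d(x)-\vec d(y)\big)=0,$$ where the sum runs over all unordered pairs $\{x,y\}\in E$ such that at least one of $x$ and $y$ belongs to the support of $\vec d$; if only one of them does, the other one is regarded as an anchor, i.e. a fixed point at which $\vec d$ takes the value $\vec 0$. The total length $L$ is the sum of the lengths of all edges not incident with a leaf.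
   Formalization: The vertex set is also assumed closed (vertices accumulate only at vertices); without this the claim fails, e.g. for a bounded planar infinite binary tree with 120° angles, shrinking edges and only two leaves, where vertices have valency 3. *)

theory Defs
  imports "HOL-Analysis.Analysis"
begin

(* A vertex is identified with its position, and an edge with the set of its two end points;
   the segment spanned by an edge e is then convex hull e. The last two conjuncts say that
   the segments meet neither each other nor the vertices, except at common end points. *)
definition straight_graph :: "(real ^ 'k) set \<Rightarrow> (real ^ 'k) set set \<Rightarrow> bool" where
  "straight_graph X E \<longleftrightarrow>
     countable X \<and>
     (\<forall>e\<in>E. \<exists>x\<in>X. \<exists>y\<in>X. x \<noteq> y \<and> e = {x, y}) \<and>
     (\<forall>e\<in>E. X \<inter> convex hull e = e) \<and>
     (\<forall>e\<in>E. \<forall>e'\<in>E. e \<noteq> e' \<longrightarrow> convex hull e \<inter> convex hull e' = e \<inter> e')"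

definition neighbours :: "(real ^ 'k) set set \<Rightarrow> real ^ 'k \<Rightarrow> (real ^ 'k) set" where
  "neighbours E x = {y. {x, y} \<in> E}"

(* This is 0 if x has infinitely many neighbours, so an upper bound on the valency is only
   meaningful together with finiteness of neighbours E x. *)
definition valency :: "(real ^ 'k) set set \<Rightarrow> real ^ 'k \<Rightarrow> nat" where
  "valency E x = card (neighbours E x)"

definition leaves :: "(real ^ 'k) set \<Rightarrow> (real ^ 'k) set set \<Rightarrow> (real ^ 'k) set" where
  "leaves X E = {x \<in> X. valency E x = 1}"

definition interior_vertices :: "(real ^ 'k) set \<Rightarrow> (real ^ 'k) set set \<Rightarrow> (real ^ 'k) set" where
  "interior_vertices X E = X - leaves X E"

(* The support in the topology of X. *)
definition field_support :: "(real ^ 'k) set \<Rightarrow> (real ^ 'k \<Rightarrow> real ^ 'k) \<Rightarrow> (real ^ 'k) set" where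
  "field_support X d = X \<inter> closure (support_on X d)"

(* The expression is symmetric in x and y, hence a function of the unordered pair. *)
definition edge_variation :: "(real ^ 'k \<Rightarrow> real ^ 'k) \<Rightarrow> (real ^ 'k) set \<Rightarrow> real" where
  "edge_variation d e =
     (THE s. \<exists>x y. e = {x, y} \<and> s = ((x - y) /\<^sub>R norm (x - y)) \<bullet> (d x - d y))"

lemma edge_variation_pair:
  "edge_variation d {x, y} = ((x - y) /\<^sub>R norm (x - y)) \<bullet> (d x - d y)"
  unfolding edge_variation_def
proof (rule the_equality)
  fix s assume "\<exists>a b. {x, y} = {a, b} \<and> s = ((a - b) /\<^sub>R norm (a - b)) \<bullet> (d a - d b)"
  then show "s = ((x - y) /\<^sub>R norm (x - y)) \<bullet> (d x - d y)"
    by (auto simp: doubleton_eq_iff norm_minus_commute inner_diff_left inner_diff_right algebra_simps)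
qed blast

(* The sum over the edges meeting the support of d can be infinite. It is taken along a sequence
   of finite sets exhausting E that does not depend on d. Unconditional convergence to 0 is a
   special case, see critical_net_if_has_sum, but demanding it would be too restrictive: when
   vertices accumulate, d can be chosen such that the series does not converge absolutely.
   At an end point outside the support d vanishes, which is the anchor convention.
   Fields with compact support do not see points where X accumulates without containing them,
   so results about all of X_int need X to be closed as well. *)
definition critical_net :: "(real ^ 'k) set \<Rightarrow> (real ^ 'k) set set \<Rightarrow> bool" where
  "critical_net X E \<longleftrightarrow>
     (\<exists>F :: nat \<Rightarrow> (real ^ 'k) set set.
        incseq F \<and> (\<forall>n. finite (F n)) \<and> (\<Union>n. F n) = E \<and>
        (\<forall>d. continuous_on X d \<and> compact (field_support X d) \<and>
             field_support X d \<subseteq> interior_vertices X E \<longrightarrow>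
             (\<lambda>n. \<Sum>e\<in>{e \<in> F n. e \<inter> field_support X d \<noteq> {}}. edge_variation d e) \<longlonglongrightarrow> 0))"

lemma critical_net_if_has_sum:
  assumes "straight_graph X E"
    and sum: "\<And>d. \<lbrakk>continuous_on X d; compact (field_support X d);
                field_support X d \<subseteq> interior_vertices X E\<rbrakk> \<Longrightarrow>
              (edge_variation d has_sum 0) {e \<in> E. e \<inter> field_support X d \<noteq> {}}"
  shows "critical_net X E"
proof -
  have "E \<subseteq> (\<lambda>(x, y). {x, y}) ` (X \<times> X)" "countable X"
    using assms(1) unfolding straight_graph_def by auto
  then have "countable E"
    by (meson countable_SIGMA countable_image countable_subset)
  then obtain f :: "_ \<Rightarrow> nat" where f: "inj_on f E"
    unfolding countable_def by blast
  define F where "F n = {e \<in> E. f e \<le> n}" for n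
  have fin: "finite (F n)" for n
  proof (rule inj_on_finite)
    show "inj_on f (F n)" using f by (rule inj_on_subset) (auto simp: F_def)
    show "f ` F n \<subseteq> {..n}" by (auto simp: F_def)
  qed simp
  have "(\<lambda>n. \<Sum>e\<in>{e \<in> F n. e \<inter> field_support X d \<noteq> {}}. edge_variation d e) \<longlonglongrightarrow> 0"
    if d: "continuous_on X d" "compact (field_support X d)"
      "field_support X d \<subseteq> interior_vertices X E" for d
  proof -
    let ?A = "{e \<in> E. e \<inter> field_support X d \<noteq> {}}"
    let ?G = "\<lambda>n. {e \<in> F n. e \<inter> field_support X d \<noteq> {}}"
    have "filterlim ?G (finite_subsets_at_top ?A) sequentially"
      unfolding filterlim_finite_subsets_at_top
    proof (intro allI impI)
      have finG: "finite (?G n)" for n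
        using fin[of n] by (rule rev_finite_subset) auto
      fix B assume B: "finite B \<and> B \<subseteq> ?A"
      then have "B \<subseteq> ?G n" if "n \<ge> Max (insert 0 (f ` B))" for n
        using that by (auto simp: F_def)
      then show "\<forall>\<^sub>F n in sequentially. finite (?G n) \<and> B \<subseteq> ?G n \<and> ?G n \<subseteq> ?A"
        unfolding eventually_sequentially
        using finG by (intro exI[of _ "Max (insert 0 (f ` B))"]) (auto simp: F_def)
    qed
    with sum[OF d] show ?thesis
      unfolding has_sum_def by (rule filterlim_compose)
  qed
  moreover have "incseq F" "(\<Union>n. F n) = E"
    by (auto simp: F_def incseq_def)
  ultimately show ?thesis
    unfolding critical_net_def using fin by blast
qed

lemma diameter_pair: "diameter {x, y} = dist x (y :: real ^ 'k)"
proof (rule antisym)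
  show "diameter {x, y} \<le> dist x y"
    by (rule diameter_le) (auto simp: dist_norm norm_minus_commute)
  show "dist x y \<le> diameter {x, y}"
    by (rule diameter_bounded_bound) auto
qed

(* Edges have length diameter e by diameter_pair. The sum is taken in ennreal, where it
   always exists. *)
definition total_length :: "(real ^ 'k) set \<Rightarrow> (real ^ 'k) set set \<Rightarrow> ennreal" where
  "total_length X E = (\<Sum>\<^sub>\<infinity>e\<in>{e \<in> E. e \<inter> leaves X E = {}}. ennreal (diameter e))"

(* For bounded S the infimum is attained; it is 0 for S = {}. *)
definition outer_radius :: "(real ^ 'k) set \<Rightarrow> real" where
  "outer_radius S = Inf {r. 0 \<le> r \<and> (\<exists>c. S \<subseteq> cball c r)}"

end

theory Submission
  imports Defs
begin

text \<open>
  Both bounds come from testing criticality against a monotone field, set to 0 on the leaves. The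
  edges between interior vertices then contribute nonnegative terms, and an edge at a leaf contributes
  at least minus the supremum of the field. There are at most as many edges of the second kind as
  leaves. The field \<open>y - c\<close>, with \<open>c\<close> the centre of a ball containing the interior vertices, makes the
  first contribution the total length. The field \<open>(y - x) / norm (y - x)\<close>, which is continuous on the
  vertices because \<open>x\<close> is isolated, gives 1 for each edge from \<open>x\<close> to an interior vertex and 0 for
  each edge from \<open>x\<close> to a leaf.
\<close>

section \<open>Closedness of the interior and counting of leaf edges\<close>

lemma straight_graph_edgeE:
  assumes "straight_graph X E" "e \<in> E"
  obtains x y where "x \<in> X" "y \<in> X" "x \<noteq> y" "e = {x, y}"
  using assms unfolding straight_graph_def by meson

lemma closed_diff_isolated:
  fixes X :: "'a::t1_space set"
  assumes "closed X" "x isolated_in X"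
  shows "closed (X - {x})"
proof -
  obtain T where "open T" "T \<inter> X = {x}"
    using assms(2) unfolding isolated_in_def by blast
  then have "X - {x} = X - T" by blast
  then show ?thesis using assms(1) \<open>open T\<close> by auto
qed

text \<open>Closedness makes a field continuous when it is extended by 0 to finitely many leaves,
  and it keeps the support among the interior vertices.\<close>

lemma closed_interior_vertices:
  assumes "closed X" "\<forall>x\<in>leaves X E. x isolated_in X"
  shows "closed (interior_vertices X E)"
proof -
  have "interior_vertices X E = X \<inter> (\<Inter>x\<in>leaves X E. X - {x})"
    unfolding interior_vertices_def by blast
  then show ?thesis
    using assms closed_diff_isolated by (metis closed_INT closed_Int)
qed

text \<open>A leaf lies on exactly one edge, so sending each leaf to its edge covers all edges that
  contain a leaf; an edge between two leaves is hit twice.\<close>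

lemma leaf_edges:
  assumes "straight_graph X E" "finite (leaves X E)"
  shows "finite {e \<in> E. e \<inter> leaves X E \<noteq> {}}"
    and "card {e \<in> E. e \<inter> leaves X E \<noteq> {}} \<le> card (leaves X E)"
proof -
  let ?f = "\<lambda>l. {l, THE y. y \<in> neighbours E l}"
  have "{e \<in> E. e \<inter> leaves X E \<noteq> {}} \<subseteq> ?f ` leaves X E"
  proof
    fix e assume e: "e \<in> {e \<in> E. e \<inter> leaves X E \<noteq> {}}"
    then obtain l where l: "l \<in> e" "l \<in> leaves X E" "e \<in> E" by blast
    obtain a b where ab: "e = {a, b}"
      using assms(1) l(3) by (rule straight_graph_edgeE)
    then obtain y where y: "e = {l, y}" using l(1) by auto
    obtain z where z: "neighbours E l = {z}"
      using l(2) unfolding leaves_def valency_def by (auto simp: card_1_singleton_iff)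
    have "y \<in> neighbours E l" using l y unfolding neighbours_def by auto
    then have "e = ?f l" using z y by auto
    then show "e \<in> ?f ` leaves X E" using l by blast
  qed
  then show "finite {e \<in> E. e \<inter> leaves X E \<noteq> {}}"
    and "card {e \<in> E. e \<inter> leaves X E \<noteq> {}} \<le> card (leaves X E)"
    using assms(2) by (blast intro: finite_surj surj_card_le)+
qed

section \<open>Testing criticality against a monotone field\<close>

text \<open>Edges from \<open>Z\<close> to leaves contribute 0 and are left out of the count.
  Summability over all interior edges is not known in advance, so a finite \<open>B\<close> is
  tested; the bound is uniform in \<open>B\<close>.\<close>

lemma critical_net_interior_sum_le:
  fixes X :: "(real ^ 'k) set"
  assumes graph: "straight_graph X E" and X: "closed X" "bounded X"
    and fin: "finite (leaves X E)" and iso: "\<forall>x\<in>leaves X E. x isolated_in X"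
    and crit: "critical_net X E"
    and cont: "continuous_on (interior_vertices X E) D"
    and bound: "\<And>x. x \<in> interior_vertices X E \<Longrightarrow> norm (D x) \<le> M"
    and mono: "\<And>x y. (x - y) \<bullet> (D x - D y) \<ge> 0"
    and zero: "Z \<subseteq> interior_vertices X E" "\<And>z. z \<in> Z \<Longrightarrow> D z = 0" and M: "0 \<le> M"
    and B: "finite B" "B \<subseteq> {e \<in> E. e \<inter> leaves X E = {}}"
  shows "(\<Sum>e\<in>B. edge_variation D e)
           \<le> M * real (card {e \<in> E. e \<inter> leaves X E \<noteq> {} \<and> e \<inter> Z = {}})"
proof -
  define d where "d x = (if x \<in> leaves X E then 0 else D x)" for x
  define P where "P = {e \<in> E. e \<inter> leaves X E \<noteq> {} \<and> e \<inter> Z = {}}"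
  have clI: "closed (interior_vertices X E)"
    using X(1) iso by (rule closed_interior_vertices)
  have Xeq: "leaves X E \<union> interior_vertices X E = X"
    by (auto simp: leaves_def interior_vertices_def)
  \<comment> \<open>Both pieces are closed and they are disjoint, so gluing 0 and \<open>D\<close>
    needs no matching condition.\<close>
  have "continuous_on (leaves X E \<union> interior_vertices X E) d"
    unfolding d_def using fin clI cont
    by (intro continuous_on_cases) (auto simp: finite_imp_closed interior_vertices_def)
  then have contd: "continuous_on X d" by (simp add: Xeq)
  have "support_on X d \<subseteq> interior_vertices X E"
    by (auto simp: support_on_def d_def interior_vertices_def)
  then have "closure (support_on X d) \<subseteq> interior_vertices X E"
    using clI by (rule closure_minimal)
  then have supp: "field_support X d \<subseteq> interior_vertices X E"
    by (auto simp: field_support_def)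
  have comp: "compact (field_support X d)"
    unfolding field_support_def using X by (auto simp: compact_eq_bounded_closed bounded_Int)
  obtain F where F: "incseq F" "\<And>n. finite (F n)" "(\<Union>n. F n) = E"
    and lim: "(\<lambda>n. \<Sum>e\<in>{e \<in> F n. e \<inter> field_support X d \<noteq> {}}. edge_variation d e) \<longlonglongrightarrow> 0"
    using crit contd supp comp unfolding critical_net_def by blast
  have d0: "d x = 0" if "x \<in> X" "x \<notin> field_support X d" for x
    using that closure_subset[of "support_on X d"]
    by (auto simp: field_support_def support_on_def)
  have ev0: "edge_variation d e = 0" if e: "e \<in> E" "e \<inter> field_support X d = {}" for e
  proof -
    obtain x y where "x \<in> X" "y \<in> X" "e = {x, y}"
      using graph e(1) by (rule straight_graph_edgeE)
    then show ?thesis using e(2) d0 by (auto simp: edge_variation_pair)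
  qed
  \<comment> \<open>Edges that miss the support contribute 0, so the partial sums may run over all
    of \<open>F n\<close>.\<close>
  have drop: "(\<Sum>e\<in>{e \<in> F n. e \<inter> field_support X d \<noteq> {}}. edge_variation d e)
      = (\<Sum>e\<in>F n. edge_variation d e)" for n
    using F ev0 by (intro sum.mono_neutral_left) auto
  have inner: "edge_variation d e = edge_variation D e"
    if e: "e \<in> E" "e \<inter> leaves X E = {}" for e
  proof -
    obtain x y where "e = {x, y}"
      using graph e(1) by (rule straight_graph_edgeE)
    then show ?thesis using e(2) by (auto simp: edge_variation_pair d_def)
  qed
  have nonneg: "edge_variation D e \<ge> 0" if e: "e \<in> E" for e
  proof -
    obtain x y where "e = {x, y}"
      using graph e by (rule straight_graph_edgeE)
    then show ?thesis using mono[of x y] by (auto simp: edge_variation_pair)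
  qed
  \<comment> \<open>Since \<open>d\<close> vanishes at the leaf \<open>y\<close>, what remains is a
    unit vector paired with \<open>d x\<close>. If \<open>x\<close> is a leaf too,
    \<open>d x = 0\<close> and the bound follows from \<open>0 \<le> M\<close>.\<close>
  have outer: "edge_variation d e \<ge> (if e \<in> P then - M else 0)"
    if e: "e \<in> E" "e \<inter> leaves X E \<noteq> {}" for e
  proof -
    obtain x y where xy: "x \<in> X" "y \<in> leaves X E" "x \<noteq> y" "e = {x, y}"
      using graph e(1) e(2)
      by (elim straight_graph_edgeE) (auto simp: insert_commute)
    have ev: "edge_variation d e = ((x - y) /\<^sub>R norm (x - y)) \<bullet> d x"
      using xy by (simp add: edge_variation_pair d_def)
    show ?thesis
    proof (cases "e \<in> P")
      case True
      have "norm (d x) \<le> M"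
        using xy(1) M bound[of x] by (auto simp: d_def interior_vertices_def)
      moreover have "\<bar>((x - y) /\<^sub>R norm (x - y)) \<bullet> d x\<bar> \<le> norm ((x - y) /\<^sub>R norm (x - y)) * norm (d x)"
        by (rule Cauchy_Schwarz_ineq2)
      moreover have "norm ((x - y) /\<^sub>R norm (x - y)) = 1" using xy(3) by simp
      ultimately show ?thesis using True unfolding ev by simp
    next
      case False
      then have "x \<in> Z"
        using e xy zero(1) unfolding P_def interior_vertices_def by auto
      then have "d x = 0" using zero(2) by (simp add: d_def)
      then show ?thesis using False unfolding ev by simp
    qed
  qed
  have finP: "finite P"
    using leaf_edges(1)[OF graph fin] unfolding P_def by (rule rev_finite_subset) auto
  \<comment> \<open>Interior edges outside \<open>B\<close> have nonnegative terms and are dropped.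
    Charging \<open>M\<close> also for edges of \<open>P\<close> outside \<open>F n\<close> only
    weakens the bound.\<close>
  have lower: "(\<Sum>e\<in>B. edge_variation D e) - M * real (card P) \<le> (\<Sum>e\<in>F n. edge_variation d e)"
    if BF: "B \<subseteq> F n" for n
  proof -
    have "- (M * real (card P)) \<le> - (M * real (card (F n \<inter> P)))"
      using finP M by (auto intro!: mult_left_mono card_mono)
    then have "(\<Sum>e\<in>B. edge_variation D e) - M * real (card P)
        \<le> (\<Sum>e\<in>F n \<inter> B. edge_variation D e) + (\<Sum>e\<in>F n \<inter> P. - M)"
      using BF by (simp add: Int_absorb1 mult.commute)
    also have "\<dots> = (\<Sum>e\<in>F n. (if e \<in> B then edge_variation D e else 0) + (if e \<in> P then - M else 0))"
      using F(2) by (simp only: sum.distrib sum.inter_restrict)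
    also have "\<dots> \<le> (\<Sum>e\<in>F n. edge_variation d e)"
    proof (rule sum_mono)
      fix e assume "e \<in> F n"
      then have e: "e \<in> E" using F(3) by blast
      show "(if e \<in> B then edge_variation D e else 0) + (if e \<in> P then - M else 0)
          \<le> edge_variation d e"
      proof (cases "e \<inter> leaves X E = {}")
        case True
        then have "e \<notin> P" by (auto simp: P_def)
        then show ?thesis using inner[OF e True] nonneg[OF e] by simp
      next
        case False
        then have "e \<notin> B" using B(2) by auto
        then show ?thesis using outer[OF e False] by simp
      qed
    qed
    finally show ?thesis .
  qed
  have "\<forall>\<^sub>F n in sequentially. \<forall>e\<in>B. e \<in> F n"
  proof (rule eventually_ball_finite[OF B(1)], rule ballI)
    fix e assume "e \<in> B"
    then obtain m where "e \<in> F m" using B(2) F(3) by blast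
    then show "\<forall>\<^sub>F n in sequentially. e \<in> F n"
      using F(1) unfolding eventually_sequentially by (meson incseqD subsetD)
  qed
  then have "\<forall>\<^sub>F n in sequentially. (\<Sum>e\<in>B. edge_variation D e) - M * real (card P)
      \<le> (\<Sum>e\<in>F n. edge_variation d e)"
    by eventually_elim (auto intro: lower)
  with lim[unfolded drop] have "(\<Sum>e\<in>B. edge_variation D e) - M * real (card P) \<le> 0"
    by (rule tendsto_lowerbound) simp
  then show ?thesis unfolding P_def by simp
qed

section \<open>Valency of an isolated vertex\<close>

text \<open>\<open>sgn\<close> is a subgradient of the convex function \<open>norm\<close>, hence
  monotone. Expanding the product gives two terms, each nonnegative by Cauchy-Schwarz.\<close>

lemma inner_sgn_diff_nonneg:
  fixes u v :: "'a::real_inner"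
  shows "(u - v) \<bullet> (sgn u - sgn v) \<ge> 0"
proof -
  have self: "w \<bullet> sgn w = norm w" for w :: 'a
    by (cases "w = 0") (auto simp: sgn_div_norm power2_norm_eq_inner[symmetric] power2_eq_square)
  have cross: "w \<bullet> sgn z \<le> norm w" for w z :: 'a
    using norm_cauchy_schwarz[of w "sgn z"] by (cases "z = 0") (auto simp: norm_sgn)
  have "(u - v) \<bullet> (sgn u - sgn v) = (norm u - u \<bullet> sgn v) + (norm v - v \<bullet> sgn u)"
    by (simp add: self inner_diff_left inner_diff_right)
  then show ?thesis using cross[of u v] cross[of v u] by simp
qed

text \<open>For an interior \<open>x\<close>, the edges at \<open>x\<close> split into
  \<open>I\<close> and \<open>L\<close>, and the leaf edges into \<open>L\<close> and
  \<open>P\<close>. Criticality gives \<open>card I \<le> card P\<close>, so the valency is at most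
  the number of leaf edges.\<close>

lemma valency_le_card_leaves:
  fixes X :: "(real ^ 'k) set"
  assumes graph: "straight_graph X E" and X: "closed X" "bounded X"
    and fin: "finite (leaves X E)" and iso: "\<forall>x\<in>leaves X E. x isolated_in X"
    and crit: "critical_net X E" and x: "x isolated_in X"
  shows "finite (neighbours E x) \<and> valency E x \<le> card (leaves X E)"
proof (cases "x \<in> leaves X E")
  case True
  then have "valency E x = 1" by (simp add: leaves_def)
  moreover have "card (leaves X E) > 0" using True fin card_gt_0_iff by blast
  \<comment> \<open>Infinite sets have \<open>card\<close> 0, so cardinality 1 also gives
    finiteness.\<close>
  ultimately show ?thesis by (auto simp: valency_def intro: card_ge_0_finite)
next
  case False
  have xI: "x \<in> interior_vertices X E"
    using x False by (auto simp: interior_vertices_def isolated_in_def)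
  define D where "D y = sgn (y - x)" for y
  define I where "I = {e \<in> E. e \<inter> leaves X E = {} \<and> x \<in> e}"
  define L where "L = {e \<in> E. e \<inter> leaves X E \<noteq> {} \<and> x \<in> e}"
  define P where "P = {e \<in> E. e \<inter> leaves X E \<noteq> {} \<and> e \<inter> {x} = {}}"
  \<comment> \<open>\<open>sgn\<close> jumps at 0, but as \<open>x\<close> is isolated,
    \<open>{x}\<close> and the remaining interior vertices are both closed, and \<open>D\<close> is
    continuous on each.\<close>
  have "closed (interior_vertices X E \<inter> (X - {x}))"
    using closed_interior_vertices[OF X(1) iso] closed_diff_isolated[OF X(1) x] by blast
  then have "continuous_on ({x} \<union> (interior_vertices X E \<inter> (X - {x}))) D"
    unfolding D_def by (intro continuous_on_closed_Un) (auto intro!: continuous_intros)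
  moreover have "{x} \<union> (interior_vertices X E \<inter> (X - {x})) = interior_vertices X E"
    using xI by (auto simp: interior_vertices_def)
  ultimately have cont: "continuous_on (interior_vertices X E) D" by simp
  \<comment> \<open>\<open>D\<close> is 0 at \<open>x\<close>, and at the other end it is the unit
    vector along the edge.\<close>
  have one: "edge_variation D e = 1" if e: "e \<in> I" for e
  proof -
    obtain a b where ab: "a \<noteq> b" "e = {a, b}"
      using graph e unfolding I_def by (blast elim: straight_graph_edgeE)
    moreover have "x = a \<or> x = b" using e ab unfolding I_def by blast
    ultimately obtain y where "y \<noteq> x" "e = {y, x}" by (metis insert_commute)
    then show ?thesis
      by (simp add: edge_variation_pair D_def sgn_div_norm power2_norm_eq_inner[symmetric]
          power2_eq_square)
  qed
  \<comment> \<open>A common bound for all finite subsets makes \<open>I\<close> itself finite. The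
    test uses \<open>M = 1\<close> and \<open>Z = {x}\<close>.\<close>
  have "card B \<le> card P" if B: "B \<subseteq> I" "finite B" for B
  proof -
    have "real (card B) = (\<Sum>e\<in>B. edge_variation D e)"
      using B(1) one by (simp add: subset_iff)
    also have "\<dots> \<le> 1 * real (card P)"
      unfolding P_def
    proof (rule critical_net_interior_sum_le[OF graph X fin iso crit cont])
      show "(y - z) \<bullet> (D y - D z) \<ge> 0" for y z
        using inner_sgn_diff_nonneg[of "y - x" "z - x"] by (simp add: D_def)
    qed (use B xI in \<open>auto simp: D_def norm_sgn I_def\<close>)
    finally show ?thesis by simp
  qed
  then have I: "finite I" "card I \<le> card P"
    using finite_if_finite_subsets_card_bdd[of I "card P"] by auto
  have LP: "L \<union> P = {e \<in> E. e \<inter> leaves X E \<noteq> {}}" "L \<inter> P = {}"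
    by (auto simp: L_def P_def)
  then have fLP: "finite L" "finite P"
    using leaf_edges(1)[OF graph fin] by (metis finite_Un)+
  have sub: "(\<lambda>y. {x, y}) ` neighbours E x \<subseteq> I \<union> L"
    by (auto simp: neighbours_def I_def L_def)
  have inj: "inj_on (\<lambda>y. {x, y}) (neighbours E x)"
    by (auto simp: inj_on_def doubleton_eq_iff)
  have "finite (I \<union> L)" using I fLP by simp
  then have "finite (neighbours E x)" "valency E x \<le> card (I \<union> L)"
    unfolding valency_def using inj_on_finite[OF inj sub] card_inj_on_le[OF inj sub] by blast+
  moreover have "card (I \<union> L) \<le> card L + card P"
    using card_Un_le[of I L] I(2) by simp
  moreover have "card L + card P \<le> card (leaves X E)"
    using leaf_edges(2)[OF graph fin] LP fLP by (metis card_Un_disjoint)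
  ultimately show ?thesis by simp
qed

section \<open>Total length\<close>

text \<open>Each radius admissible in \<open>outer_radius\<close> bounds every finite sum of
  lengths; the infimum over these radii is taken at the end.\<close>

lemma total_length_le:
  fixes X :: "(real ^ 'k) set"
  assumes graph: "straight_graph X E" and X: "closed X" "bounded X"
    and fin: "finite (leaves X E)" and iso: "\<forall>x\<in>leaves X E. x isolated_in X"
    and crit: "critical_net X E"
  shows "total_length X E \<le>
           ennreal (outer_radius (interior_vertices X E) * real (card (leaves X E)))"
  unfolding total_length_def
proof (rule infsum_le_finite_sums)
  let ?N = "real (card (leaves X E))"
  let ?R = "{r. 0 \<le> r \<and> (\<exists>c. interior_vertices X E \<subseteq> cball c r)}"
  fix B assume B: "finite B" "B \<subseteq> {e \<in> E. e \<inter> leaves X E = {}}"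
  have le: "(\<Sum>e\<in>B. diameter e) \<le> r * ?N" if r: "r \<in> ?R" for r
  proof -
    obtain c where c: "interior_vertices X E \<subseteq> cball c r" and r0: "0 \<le> r" using r by blast
    define D where "D y = y - c" for y
    have "diameter e = edge_variation D e" if e: "e \<in> B" for e
    proof -
      obtain x y where "x \<noteq> y" "e = {x, y}"
        using graph B(2) e by (blast elim: straight_graph_edgeE)
      then show ?thesis
        by (simp add: edge_variation_pair diameter_pair D_def dist_norm
            power2_norm_eq_inner[symmetric] power2_eq_square)
    qed
    then have "(\<Sum>e\<in>B. diameter e) = (\<Sum>e\<in>B. edge_variation D e)" by simp
    also have "\<dots> \<le> r * real (card {e \<in> E. e \<inter> leaves X E \<noteq> {} \<and> e \<inter> {} = {}})"
    proof (rule critical_net_interior_sum_le[OF graph X fin iso crit])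
      show "continuous_on (interior_vertices X E) D"
        unfolding D_def by (intro continuous_intros)
      show "norm (D x) \<le> r" if "x \<in> interior_vertices X E" for x
        using that c by (auto simp: D_def dist_norm norm_minus_commute)
    qed (use B r0 in \<open>auto simp: D_def\<close>)
    also have "\<dots> \<le> r * ?N"
      using leaf_edges(2)[OF graph fin] r0 by (intro mult_left_mono) auto
    finally show ?thesis .
  qed
  have "bounded (interior_vertices X E)"
    using X(2) by (rule bounded_subset) (auto simp: interior_vertices_def)
  then obtain r c where "interior_vertices X E \<subseteq> cball c r"
    unfolding bounded_subset_cball by blast
  \<comment> \<open>Without interior vertices \<open>r\<close> may be negative, whereas
    \<open>?R\<close> asks for nonnegative radii.\<close>
  then have "\<bar>r\<bar> \<in> ?R" by (auto intro!: exI[of _ c])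
  then have ne: "?R \<noteq> {}" by blast
  have "(\<Sum>e\<in>B. diameter e) \<le> Inf ?R * ?N"
  \<comment> \<open>The infimum is reached after dividing by \<open>?N\<close>; for
    \<open>?N = 0\<close> any single radius already gives the bound 0.\<close>
  proof (cases "?N = 0")
    case True
    then show ?thesis using le ne by auto
  next
    case False
    then have "(\<Sum>e\<in>B. diameter e) / ?N \<le> Inf ?R"
      using le by (intro cInf_greatest[OF ne]) (auto simp: divide_le_eq)
    then show ?thesis using False by (simp add: divide_le_eq)
  qed
  moreover have "0 \<le> diameter e" if "e \<in> B" for e
    using graph B(2) that by (auto elim!: straight_graph_edgeE simp: diameter_pair)
  ultimately show "(\<Sum>e\<in>B. ennreal (diameter e))
      \<le> ennreal (outer_radius (interior_vertices X E) * ?N)"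
    unfolding outer_radius_def by (simp add: sum_ennreal ennreal_leI)
qed (rule nonneg_summable_on_complete, simp)

theorem theoremA:
  fixes X :: "(real ^ 'k) set" and E :: "(real ^ 'k) set set"
  assumes "straight_graph X E"
    and "\<forall>x\<in>X. valency E x \<noteq> 2"
    and "closed X"
    and "bounded X"
    and "finite (leaves X E)"
    and "card (leaves X E) \<ge> 2"
    and "\<forall>x\<in>leaves X E. x isolated_in X"
    and "critical_net X E"
  shows "(\<forall>x. x isolated_in X \<longrightarrow>
            finite (neighbours E x) \<and> valency E x \<le> card (leaves X E)) \<and>
         total_length X E \<le>
            ennreal (outer_radius (interior_vertices X E) * real (card (leaves X E)))"
  using valency_le_card_leaves[OF assms(1,3,4,5,7,8)] total_length_le[OF assms(1,3,4,5,7,8)]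
  by simp

end
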